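(* Let $\mathbb{K}$ be an algebraically closed field of characteristic zero. Almost every holonomic sequence of order $l$ and degree $d$ is a D-algebraic zero of a rationalizing difference polynomial of order at most $l+d$ in $\mathbb{K}[s(n),s(n+1),s(n+2),\ldots]$. That is, for every holonomic difference polynomial $p$ of order $l$ and holonomic degree $d$ there is a rationalizing difference polynomial $q$ with coefficients in $\mathbb{K}$ (free of the index variable $n$) of order at most $l+d$ such that almost all zeros of $p$ are D-algebraic zeros of $q$.
   Context: Write $\sigma^j(s(n))=s(n+j)$. Let $\mathbb{D}_s=\mathbb{K}[s(n+j)\mid j\in\mathbb{N}]$ and $\mathbb{D}_s(n)=\mathbb{K}(n)[s(n+j)\mid j\in\mathbb{N}]$, with shift $\sigma$ sending $s(n+j)\mapsto s(n+j+1)$ (and $n\mapsto n+1$ in $\mathbb{D}_s(n)$). The order of a difference polynomial is the largest $j$ such that $s(n+j)$ occurs in it. The initial $\mathcal{I}_q$ of $q$ is the leading coefficient of $q$ as a univariate polynomial in its highest shift $s(n+\mathrm{ord}(q))$. A difference polynomial is rationalizing if its degree in its highest shift is $1$. A holonomic difference polynomial of order $l$ is $p=\sum_{i=0}^{l}P_i(n)s(n+i)\in\mathbb{D}_s(n)$ with $P_i\in\mathbb{K}[n]$, $P_l\neq 0$; its holonomic degree is its degree as a polynomial in $n$. Almost all. Let $p$ be a holonomic difference polynomial of order $l_1$, and $q\in\mathbb{D}_s$ of order $l_2\ge l_1$. Let $N$ be the maximum nonnegative integer root of the (nonzero) polynomial coefficients of $p$ (with $N=-1$ if there is none). Let $(\epsilon_p(n))_{n>N}$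 be the sequence satisfying the recurrence $p=0$ at all indices $n\ge N+1$ (i.e. the solution of $\sigma^{N+1}(p)$) with symbolic initial terms $\epsilon_p(N+j)=X_j$, $j=1,\ldots,l_1$, where $X_1,\ldots,X_{l_1}$ are distinct indeterminates over $\mathbb{K}$; its terms lie in $\mathbb{K}(X_1,\ldots,X_{l_1})$. Almost all zeros of $p$ are D-algebraic zeros of $q$ if $(\epsilon_p(n))_{n>N}$ is a D-algebraic zero of $q$: $q$ is irreducible, substituting $s(n+j)\mapsto\epsilon_p(n+j)$ makes $q$ vanish for all $n>N$, and the same substitution makes $\mathcal{I}_q$ nonzero for all sufficiently large $n$. Almost every holonomic sequence is a D-algebraic zero of a family $\mathcal{F}$ of difference polynomials if for every holonomic difference polynomial $p$ (here: of order $l$ and degree $d$), almost all zeros of $p$ are D-algebraic zeros of some $q\in\mathcal{F}$. *)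

theory Defs
  imports
    "HOL-Library.Poly_Mapping"
    "HOL-Computational_Algebra.Computational_Algebra"
begin

text \<open>
  Polynomials in countably many indeterminates indexed by \<open>nat\<close>: finitely supported maps from
  monomials (finitely supported exponent vectors) to coefficients, with the ring structure of
  \<open>Poly_Mapping\<close>.  The type is used in three roles:
  \<^item> \<open>'a mpoly\<close> as the difference polynomial ring K[s(n+j) | j in N], indeterminate
    \<open>j\<close> being \<open>s(n+j)\<close>;
  \<^item> \<open>'a poly mpoly\<close> as K[n][s(n+j) | j in N], the subring of K(n)[s(n+j) | j in N] in which
    holonomic difference polynomials live, the indeterminate of \<open>'a poly\<close> being \<open>n\<close>;
  \<^item> \<open>'a mpoly fract\<close> as a field K(X_1, X_2, ...) containing the symbolic initial terms.
\<close>

type_synonym 'a mpoly = "(nat \<Rightarrow>\<^sub>0 nat) \<Rightarrow>\<^sub>0 'a"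

definition Const :: "'a::zero \<Rightarrow> 'a mpoly" where
  "Const c = Poly_Mapping.single 0 c"

definition Var :: "nat \<Rightarrow> 'a::zero_neq_one mpoly" where
  "Var j = Poly_Mapping.single (Poly_Mapping.single j 1) 1"

text \<open>The order of a constant, which the mathematics leaves undefined, is set to \<open>0\<close>.\<close>

definition diff_ord :: "'a::zero mpoly \<Rightarrow> nat" where
  "diff_ord q = Max (insert 0 (\<Union>m\<in>Poly_Mapping.keys q. Poly_Mapping.keys m))"

definition degree_in :: "nat \<Rightarrow> 'a::zero mpoly \<Rightarrow> nat" where
  "degree_in j q = Max (insert 0 ((\<lambda>m. Poly_Mapping.lookup m j) ` Poly_Mapping.keys q))"

text \<open>The coefficient of \<open>s(n+j)^k\<close> in \<open>q\<close>, regarded as a univariate polynomial in \<open>s(n+j)\<close>.\<close>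

definition coeff_in :: "nat \<Rightarrow> nat \<Rightarrow> 'a::comm_monoid_add mpoly \<Rightarrow> 'a mpoly" where
  "coeff_in j k q =
     (\<Sum>m\<in>{m \<in> Poly_Mapping.keys q. Poly_Mapping.lookup m j = k}.
        Poly_Mapping.single (Poly_Mapping.update j 0 m) (Poly_Mapping.lookup q m))"

definition initial :: "'a::comm_monoid_add mpoly \<Rightarrow> 'a mpoly" where
  "initial q = coeff_in (diff_ord q) (degree_in (diff_ord q) q) q"

definition rationalizing :: "'a::zero mpoly \<Rightarrow> bool" where
  "rationalizing q \<longleftrightarrow> degree_in (diff_ord q) q = 1"

text \<open>Substitution of \<open>x j\<close> for \<open>s(n+j)\<close>, with \<open>h\<close> applied to the coefficients.\<close>

definition subst_mpoly ::
    "('a::zero \<Rightarrow> 'b::comm_semiring_1) \<Rightarrow> (nat \<Rightarrow> 'b) \<Rightarrow> 'a mpoly \<Rightarrow> 'b" where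
  "subst_mpoly h x q =
     (\<Sum>m\<in>Poly_Mapping.keys q. h (Poly_Mapping.lookup q m) *
        (\<Prod>j\<in>Poly_Mapping.keys m. x j ^ Poly_Mapping.lookup m j))"

definition holonomic :: "'a::field poly mpoly \<Rightarrow> nat \<Rightarrow> bool" where
  "holonomic p l \<longleftrightarrow>
     (\<exists>P :: nat \<Rightarrow> 'a poly. P l \<noteq> 0 \<and> p = (\<Sum>i\<le>l. Const (P i) * Var i))"

definition holonomic_degree :: "'a::field poly mpoly \<Rightarrow> nat" where
  "holonomic_degree p =
     Max (insert 0 ((\<lambda>m. Polynomial.degree (Poly_Mapping.lookup p m)) ` Poly_Mapping.keys p))"

text \<open>
  The nonnegative integer roots of the nonzero coefficients of \<open>p\<close>; a finite set in
  characteristic zero.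
\<close>

definition nat_roots :: "'a::field_char_0 poly mpoly \<Rightarrow> nat set" where
  "nat_roots p = {k. \<exists>m\<in>Poly_Mapping.keys p. poly (Poly_Mapping.lookup p m) (of_nat k) = 0}"

definition max_root :: "'a::field_char_0 poly mpoly \<Rightarrow> int" where
  "max_root p = (if nat_roots p = {} then - 1 else int (Max (nat_roots p)))"

definition emb :: "'a::field_char_0 \<Rightarrow> 'a mpoly fract" where
  "emb c = to_fract (Const c)"

text \<open>
  The value of \<open>p\<close> at index \<open>n\<close> along a sequence \<open>e\<close>: both the coefficients and the shifts of
  \<open>s\<close> are specialized.  An element of K[s(n+j) | j in N] has no explicit \<open>n\<close>, so that only the
  shifts are.
\<close>

definition hol_value ::
    "'a::field_char_0 poly mpoly \<Rightarrow> (nat \<Rightarrow> 'a mpoly fract) \<Rightarrow> nat \<Rightarrow> 'a mpoly fract" where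
  "hol_value p e n = subst_mpoly (\<lambda>c. emb (poly c (of_nat n))) (\<lambda>j. e (n + j)) p"

definition diff_value ::
    "'a::field_char_0 mpoly \<Rightarrow> (nat \<Rightarrow> 'a mpoly fract) \<Rightarrow> nat \<Rightarrow> 'a mpoly fract" where
  "diff_value q e n = subst_mpoly emb (\<lambda>j. e (n + j)) q"

text \<open>
  \<open>e\<close> is the solution of \<open>p = 0\<close> with symbolic initial terms.  Since the leading coefficient of
  \<open>p\<close> has no root beyond \<open>N = max_root p\<close>, this determines \<open>e n\<close> for all \<open>n > N\<close>; the values
  \<open>e n\<close> with \<open>n \<le> N\<close> are junk and are not referred to.
\<close>

definition generic_solution ::
    "'a::field_char_0 poly mpoly \<Rightarrow> (nat \<Rightarrow> 'a mpoly fract) \<Rightarrow> bool" where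
  "generic_solution p e \<longleftrightarrow>
     (\<forall>j\<in>{1..diff_ord p}. e (nat (max_root p + int j)) = to_fract (Var j)) \<and>
     (\<forall>n. int n > max_root p \<longrightarrow> hol_value p e n = 0)"

text \<open>The sequence \<open>(e n)\<close>, \<open>n > N\<close>, is a D-algebraic zero of \<open>q\<close>.\<close>

definition D_algebraic_zero ::
    "int \<Rightarrow> (nat \<Rightarrow> 'a::field_char_0 mpoly fract) \<Rightarrow> 'a mpoly \<Rightarrow> bool" where
  "D_algebraic_zero N e q \<longleftrightarrow>
     irreducible q \<and>
     (\<forall>n. int n > N \<longrightarrow> diff_value q e n = 0) \<and>
     (\<forall>\<^sub>F n in sequentially. diff_value (initial q) e n \<noteq> 0)"

definition almost_all_zeros ::
    "'a::field_char_0 poly mpoly \<Rightarrow> 'a mpoly \<Rightarrow> bool" where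
  "almost_all_zeros p q \<longleftrightarrow>
     diff_ord p \<le> diff_ord q \<and> (\<exists>e. generic_solution p e \<and> D_algebraic_zero (max_root p) e q)"

definition almost_every_holonomic ::
    "nat \<Rightarrow> nat \<Rightarrow> 'a::field_char_0 mpoly set \<Rightarrow> bool" where
  "almost_every_holonomic l d F \<longleftrightarrow>
     (\<forall>p :: 'a poly mpoly. holonomic p l \<and> holonomic_degree p = d \<longrightarrow>
        (\<exists>q\<in>F. almost_all_zeros p q))"

end

theory Submission
  imports Defs
begin

text \<open>
  Write \<open>P\<^sub>0, ..., P\<^sub>l\<close> for the coefficients of \<open>p\<close>.  The difference polynomials that vanish along the
  generic solution \<open>e\<close> at all indices \<open>n > N\<close> form a prime ideal \<open>J\<close>, provided that only shifts
  \<open>s(n+j)\<close> with \<open>j \<ge> t\<close> are used, where \<open>t\<close> is the least index with \<open>P\<^sub>t \<noteq> 0\<close>.  What makes it prime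
  is a dichotomy (\<open>vanishing_or_eventually_nonzero\<close>): along \<open>e\<close>, such a polynomial either vanishes
  at every index or is nonzero at all large ones.  Indeed the recurrence rewrites it, up to a nonzero
  factor in K[n], as a polynomial in \<open>n\<close> whose coefficients involve only \<open>e(n+t), ..., e(n+l-1)\<close>; these
  are algebraically independent over K, since running the recurrence backwards recovers the initial
  terms (\<open>inverse_substitution\<close>), and a nonzero polynomial in \<open>n\<close> has finitely many roots.

  Let \<open>A\<^sub>m\<close> be K[s(n+t), ..., s(n+m-1)] modulo \<open>J\<close>.  It is enough to find \<open>m\<close> between \<open>l\<close> and
  \<open>l + d\<close> such that \<open>s(n+m)\<close> lies in the fraction field of \<open>A\<^sub>m\<close>, say \<open>u + v s(n+m) \<in> J\<close> with
  \<open>v \<notin> J\<close>: because \<open>J\<close> is prime, a polynomial of this form of least total degree is irreducible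
  (\<open>ex_irreducible_solves_for\<close>).

  Such an \<open>m\<close> exists because \<open>n\<close> is algebraic over these fields, of a degree that cannot drop more
  than \<open>d\<close> times (\<open>annihilator_imp_rational_at\<close>).  For every \<open>m \<ge> l\<close> the shifted recurrence
  has the form \<open>U(n) + s(n+m) V(n) = 0\<close>, where \<open>U, V \<in> A\<^sub>m[x]\<close> have degree at most \<open>d\<close> and
  \<open>V(x) = P\<^sub>l(x+m-l)\<close>.  Given a nonzero \<open>g \<in> A\<^sub>m[x]\<close> with root \<open>n\<close>, both \<open>U\<close> and \<open>V\<close> can be reduced
  modulo \<open>g\<close> by pseudo-division.  If \<open>U + s(n+m) V\<close> is now the zero polynomial, comparing one
  coefficient solves for \<open>s(n+m)\<close> rationally.  Otherwise it is a polynomial over \<open>A\<^bsub>m+1\<^esub>\<close> with root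
  \<open>n\<close> and of smaller degree than \<open>g\<close>, and the argument is repeated with it.  The start is the recurrence
  itself, of degree at most \<open>d\<close> over \<open>A\<^bsub>l+1\<^esub>\<close>.
\<close>

section \<open>Substitution into difference polynomials\<close>

lemma Const_0 [simp]: "Const 0 = 0"
  by (simp add: Const_def)

lemma Const_1 [simp]: "Const 1 = 1"
  by (simp add: Const_def)

lemma Const_add: "Const (a + b) = Const a + Const b"
  by (simp add: Const_def single_add)

lemma Const_mult: "Const (a * b) = Const a * Const b"
  by (simp add: Const_def mult_single)

lemma Const_eq_0_iff [simp]: "Const c = 0 \<longleftrightarrow> c = 0"
  by (metis Const_def inj_single injD single_zero)

lemma Const_of_nat: "Const (of_nat n) = of_nat n"
  by (simp add: Const_def)

lemma single_eq_Var_power: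
  "Poly_Mapping.single (Poly_Mapping.single j n) 1 = (Var j :: 'a::comm_semiring_1 mpoly) ^ n"
proof (induction n)
  case (Suc n)
  have "Poly_Mapping.single (Poly_Mapping.single j (Suc n)) (1::'a) =
      Poly_Mapping.single (Poly_Mapping.single j n) 1 * Var j"
    by (simp add: Var_def mult_single flip: single_add)
  then show ?case using Suc by (simp add: mult.commute)
qed simp

text \<open>
  A monomial is a product of powers of indeterminates, so exponent vectors and polynomials can both
  be built up one key at a time.  The principle makes it enough to compare ring homomorphisms on
  constants and indeterminates.
\<close>

lemma mpoly_induct [case_names Const Var add mult]:
  fixes q :: "'a::comm_semiring_1 mpoly"
  assumes "\<And>c. Q (Const c)" and "\<And>j. Q (Var j)"
    and add: "\<And>a b. Q a \<Longrightarrow> Q b \<Longrightarrow> Q (a + b)" and mult: "\<And>a b. Q a \<Longrightarrow> Q b \<Longrightarrow> Q (a * b)"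
  shows "Q q"
proof -
  have upd: "Poly_Mapping.update a b f = f + Poly_Mapping.single a b"
    if "a \<notin> Poly_Mapping.keys f" for a b and f :: "'c \<Rightarrow>\<^sub>0 'd::comm_monoid_add"
    using that by (intro poly_mapping_eqI)
      (auto simp: lookup_update lookup_add lookup_single in_keys_iff when_def)
  have pow: "Q (Var j ^ n)" for j n
    using assms(1)[of 1] assms(2)[of j] by (induction n) (simp_all add: mult)
  have mono: "Q (Poly_Mapping.single m c)" for m c
  proof (induction m rule: update_induct)
    case const
    then show ?case using assms(1) by (simp add: Const_def)
  next
    case (update m j n)
    have "Poly_Mapping.single (Poly_Mapping.update j n m) c =
        Poly_Mapping.single m c * Var j ^ n"
      using update(1) by (simp add: upd mult_single flip: single_eq_Var_power)
    then show ?case using update pow mult by metis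
  qed
  show ?thesis
  proof (induction q rule: update_induct)
    case const
    then show ?case using assms(1)[of 0] by simp
  next
    case (update q m c)
    then show ?case using mono add by (simp add: upd)
  qed
qed

lemma mpoly_eq_sum_single:
  fixes q :: "'a::comm_monoid_add mpoly"
  shows "q = (\<Sum>m\<in>Poly_Mapping.keys q. Poly_Mapping.single m (Poly_Mapping.lookup q m))"
  by (intro poly_mapping_eqI)
    (simp add: lookup_sum lookup_single when_def in_keys_iff)

definition monom_value :: "(nat \<Rightarrow> 'b::comm_semiring_1) \<Rightarrow> (nat \<Rightarrow>\<^sub>0 nat) \<Rightarrow> 'b" where
  "monom_value x m = (\<Prod>j\<in>Poly_Mapping.keys m. x j ^ Poly_Mapping.lookup m j)"

lemma monom_value_superset:
  assumes "finite A" "Poly_Mapping.keys m \<subseteq> A"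
  shows "monom_value x m = (\<Prod>j\<in>A. x j ^ Poly_Mapping.lookup m j)"
  unfolding monom_value_def using assms
  by (intro prod.mono_neutral_left) (auto simp: in_keys_iff)

lemma monom_value_add: "monom_value x (m + m') = monom_value x m * monom_value x m'"
proof -
  let ?A = "Poly_Mapping.keys m \<union> Poly_Mapping.keys m'"
  have "Poly_Mapping.keys (m + m') \<subseteq> ?A" by (rule keys_add)
  then show ?thesis
    by (simp add: monom_value_superset[of ?A] lookup_add power_add prod.distrib)
qed

locale ring_homomorphism =
  fixes h :: "'a::comm_ring_1 \<Rightarrow> 'b::comm_ring_1"
  assumes hom_1 [simp]: "h 1 = 1"
    and hom_add: "h (a + b) = h a + h b"
    and hom_mult: "h (a * b) = h a * h b"
begin

lemma hom_0 [simp]: "h 0 = 0"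
  using hom_add[of 0 0] by simp

lemma hom_uminus: "h (- a) = - h a"
  using hom_add[of "- a" a] by (simp add: eq_neg_iff_add_eq_0)

lemma hom_diff: "h (a - b) = h a - h b"
  using hom_add[of a "- b"] by (simp add: hom_uminus)

lemma hom_sum: "h (\<Sum>i\<in>I. f i) = (\<Sum>i\<in>I. h (f i))"
  by (induction I rule: infinite_finite_induct) (simp_all add: hom_add)

lemma hom_power: "h (a ^ n) = h a ^ n"
  by (induction n) (simp_all add: hom_mult)

lemma hom_of_nat: "h (of_nat n) = of_nat n"
  by (induction n) (simp_all add: hom_add)

end

lemma ring_homomorphism_Const: "ring_homomorphism Const"
  by unfold_locales (simp_all add: Const_add Const_mult)

context ring_homomorphism
begin

lemma subst_superset:
  assumes "finite A" "Poly_Mapping.keys q \<subseteq> A"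
  shows "subst_mpoly h x q = (\<Sum>m\<in>A. h (Poly_Mapping.lookup q m) * monom_value x m)"
  unfolding subst_mpoly_def monom_value_def using assms
  by (intro sum.mono_neutral_left) (auto simp: in_keys_iff)

lemma subst_add: "subst_mpoly h x (p + q) = subst_mpoly h x p + subst_mpoly h x q"
proof -
  let ?A = "Poly_Mapping.keys p \<union> Poly_Mapping.keys q"
  have "Poly_Mapping.keys (p + q) \<subseteq> ?A" by (rule keys_add)
  then show ?thesis
    by (simp add: subst_superset[of ?A] lookup_add hom_add distrib_right sum.distrib)
qed

lemma subst_single: "subst_mpoly h x (Poly_Mapping.single m c) = h c * monom_value x m"
  by (cases "c = 0") (simp_all add: subst_superset[of "{m}"] subst_mpoly_def monom_value_def)

lemma subst_Const [simp]: "subst_mpoly h x (Const c) = h c"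
  unfolding Const_def subst_single by (simp add: monom_value_def)

lemma subst_Var [simp]: "subst_mpoly h x (Var j) = x j"
  unfolding Var_def subst_single by (simp add: monom_value_def)

lemma subst_sum: "subst_mpoly h x (\<Sum>i\<in>I. f i) = (\<Sum>i\<in>I. subst_mpoly h x (f i))"
  by (induction I rule: infinite_finite_induct) (simp_all add: subst_add, simp_all add: subst_mpoly_def)

lemma subst_mult: "subst_mpoly h x (p * q) = subst_mpoly h x p * subst_mpoly h x q"
proof -
  have "p * q = (\<Sum>m\<in>Poly_Mapping.keys p. \<Sum>m'\<in>Poly_Mapping.keys q.
      Poly_Mapping.single (m + m') (Poly_Mapping.lookup p m * Poly_Mapping.lookup q m'))"
    by (subst mpoly_eq_sum_single[of p], subst mpoly_eq_sum_single[of q])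
      (simp add: sum_product mult_single)
  then have "subst_mpoly h x (p * q) = (\<Sum>m\<in>Poly_Mapping.keys p. \<Sum>m'\<in>Poly_Mapping.keys q.
      (h (Poly_Mapping.lookup p m) * monom_value x m) * (h (Poly_Mapping.lookup q m') * monom_value x m'))"
    by (simp add: subst_sum subst_single hom_mult monom_value_add mult_ac)
  also have "\<dots> = subst_mpoly h x p * subst_mpoly h x q"
    by (simp add: sum_product subst_mpoly_def monom_value_def)
  finally show ?thesis .
qed

lemma ring_homomorphism_subst: "ring_homomorphism (subst_mpoly h x)"
  using subst_Const[of x 1] by unfold_locales (simp_all add: subst_add subst_mult)

end

interpretation Const: ring_homomorphism Const
  by (rule ring_homomorphism_Const)

lemma hom_eqI:
  fixes F G :: "'a::comm_ring_1 mpoly \<Rightarrow> 'b::comm_ring_1"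
  assumes "ring_homomorphism F" "ring_homomorphism G"
    and "\<And>c. F (Const c) = G (Const c)" and "\<And>j. F (Var j) = G (Var j)"
  shows "F q = G q"
  using assms
  by (induction q rule: mpoly_induct) (simp_all add: ring_homomorphism.hom_add ring_homomorphism.hom_mult)

lemma ring_homomorphism_comp: "ring_homomorphism F \<Longrightarrow> ring_homomorphism G \<Longrightarrow> ring_homomorphism (\<lambda>q. F (G q))"
  by (simp add: ring_homomorphism_def)

lemma ring_homomorphism_poly: "ring_homomorphism (\<lambda>q. poly q a)"
  by unfold_locales simp_all

lemma ring_homomorphism_pCons_Const: "ring_homomorphism (\<lambda>c. [:Const c:])"
  by unfold_locales (simp_all add: Const_add Const_mult one_pCons)

lemma ring_homomorphism_id: "ring_homomorphism (\<lambda>q. q)"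
  by unfold_locales simp_all

section \<open>Degrees in one indeterminate\<close>

text \<open>
  The coefficients stay in \<open>'a mpoly\<close>, although the indeterminate \<open>j\<close> no longer occurs in them, so
  that evaluation at \<open>Var j\<close> recovers the polynomial.  Degrees and coefficients in one
  indeterminate thereby inherit the theory of univariate polynomials over an integral domain.
\<close>

definition univ_in :: "nat \<Rightarrow> 'a::comm_ring_1 mpoly \<Rightarrow> 'a mpoly poly" where
  "univ_in j = subst_mpoly (\<lambda>c. [:Const c:]) (\<lambda>i. if i = j then [:0, 1:] else [:Var i:])"

interpretation univ_coeff: ring_homomorphism "\<lambda>c. [:Const c:]"
  by (rule ring_homomorphism_pCons_Const)

lemma ring_homomorphism_univ_in: "ring_homomorphism (univ_in j)"
  unfolding univ_in_def by (rule univ_coeff.ring_homomorphism_subst)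

interpretation univ_in: ring_homomorphism "univ_in j"
  by (rule ring_homomorphism_univ_in)

lemma univ_in_Const [simp]: "univ_in j (Const c) = [:Const c:]"
  by (simp add: univ_in_def)

lemma univ_in_Var: "univ_in j (Var i) = (if i = j then [:0, 1:] else [:Var i:])"
  by (simp add: univ_in_def)

lemma poly_univ_in: "poly (univ_in j q) (Var j) = q"
  by (rule hom_eqI[OF ring_homomorphism_comp[OF ring_homomorphism_poly ring_homomorphism_univ_in] ring_homomorphism_id])
    (simp_all add: univ_in_Var)

lemma update_0_add_single:
  "Poly_Mapping.update j 0 m + Poly_Mapping.single j (Poly_Mapping.lookup m j) = m"
  by (rule poly_mapping_eqI) (simp add: lookup_add lookup_update lookup_single when_def)

lemma univ_in_eq_const:
  assumes "\<And>m. m \<in> Poly_Mapping.keys q \<Longrightarrow> j \<notin> Poly_Mapping.keys m"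
  shows "univ_in j q = [:q:]"
proof -
  have "univ_in j q = subst_mpoly (\<lambda>c. [:Const c:]) (\<lambda>i. [:Var i:]) q"
    unfolding univ_in_def subst_mpoly_def using assms
    by (intro sum.cong refl arg_cong2[of _ _ _ _ "(*)"] prod.cong) auto
  also have "\<dots> = [:q:]"
    by (rule hom_eqI[OF univ_coeff.ring_homomorphism_subst]) (unfold_locales, simp_all add: one_pCons)
  finally show ?thesis .
qed

lemma univ_in_single:
  "univ_in j (Poly_Mapping.single m c) =
    monom (Poly_Mapping.single (Poly_Mapping.update j 0 m) c) (Poly_Mapping.lookup m j)"
proof -
  let ?n = "Poly_Mapping.lookup m j" and ?m = "Poly_Mapping.update j 0 m"
  have "Poly_Mapping.single m c = Poly_Mapping.single ?m c * Var j ^ ?n"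
    by (simp add: mult_single update_0_add_single flip: single_eq_Var_power)
  then have "univ_in j (Poly_Mapping.single m c) = univ_in j (Poly_Mapping.single ?m c) * [:0, 1:] ^ ?n"
    by (simp add: univ_in.hom_mult univ_in.hom_power univ_in_Var)
  also have "univ_in j (Poly_Mapping.single ?m c) = [:Poly_Mapping.single ?m c:]"
    by (rule univ_in_eq_const) (auto simp: in_keys_iff lookup_update split: if_splits)
  finally show ?thesis by (simp add: monom_altdef)
qed

lemma univ_in_eq_sum_monom:
  "univ_in j q = (\<Sum>m\<in>Poly_Mapping.keys q.
    monom (Poly_Mapping.single (Poly_Mapping.update j 0 m) (Poly_Mapping.lookup q m)) (Poly_Mapping.lookup m j))"
  by (subst mpoly_eq_sum_single) (simp add: univ_in.hom_sum univ_in_single)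

lemma coeff_univ_in: "coeff (univ_in j q) k = coeff_in j k q"
  unfolding univ_in_eq_sum_monom coeff_in_def coeff_sum
  by (simp add: sum.If_cases Int_def flip: sum.inter_filter)

lemma degree_in_ge: "m \<in> Poly_Mapping.keys q \<Longrightarrow> Poly_Mapping.lookup m j \<le> degree_in j q"
  by (simp add: degree_in_def)

text \<open>
  Setting the exponent of \<open>j\<close> to \<open>0\<close> is injective on the monomials of a given degree in \<open>j\<close>, so the
  terms that contribute to one coefficient do not cancel.
\<close>

lemma degree_univ_in: "degree (univ_in j q) = degree_in j q"
proof (rule antisym)
  show "degree (univ_in j q) \<le> degree_in j q"
    unfolding univ_in_eq_sum_monom
    by (intro degree_sum_le order.trans[OF degree_monom_le] degree_in_ge) auto
next
  have *: "Poly_Mapping.lookup (coeff (univ_in j q) (Poly_Mapping.lookup m j)) (Poly_Mapping.update j 0 m) =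
      Poly_Mapping.lookup q m" if "m \<in> Poly_Mapping.keys q" for m
  proof -
    let ?A = "{m' \<in> Poly_Mapping.keys q. Poly_Mapping.lookup m' j = Poly_Mapping.lookup m j}"
    have "Poly_Mapping.lookup (coeff (univ_in j q) (Poly_Mapping.lookup m j)) (Poly_Mapping.update j 0 m) =
        (\<Sum>m'\<in>?A. if m' = m then Poly_Mapping.lookup q m' else 0)"
      unfolding coeff_univ_in coeff_in_def lookup_sum lookup_single when_def
      by (intro sum.cong refl) (metis (mono_tags, lifting) mem_Collect_eq update_0_add_single)
    then show ?thesis using that by simp
  qed
  have "Poly_Mapping.lookup m j \<le> degree (univ_in j q)" if "m \<in> Poly_Mapping.keys q" for m
    using *[OF that] that by (intro le_degree) (auto simp: in_keys_iff)
  then show "degree_in j q \<le> degree (univ_in j q)"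
    by (auto simp: degree_in_def)
qed

lemma degree_in_0 [simp]: "degree_in j (0 :: 'a::comm_ring_1 mpoly) = 0"
  by (simp flip: degree_univ_in)

lemma degree_in_Const [simp]: "degree_in j (Const c :: 'a::comm_ring_1 mpoly) = 0"
  by (simp flip: degree_univ_in)

lemma degree_in_Var: "degree_in j (Var i :: 'a::comm_ring_1 mpoly) = (if i = j then 1 else 0)"
  by (simp add: univ_in_Var flip: degree_univ_in)

lemma degree_in_mult:
  fixes a b :: "'a::idom mpoly"
  assumes "a \<noteq> 0" "b \<noteq> 0"
  shows "degree_in j (a * b) = degree_in j a + degree_in j b"
proof -
  have "univ_in j a \<noteq> 0" "univ_in j b \<noteq> 0"
    using assms by (metis poly_univ_in poly_0)+
  then show ?thesis
    by (simp add: univ_in.hom_mult degree_mult_eq flip: degree_univ_in)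
qed

lemma univ_in_eq_const_iff: "univ_in j q = [:q:] \<longleftrightarrow> degree_in j q = 0"
proof
  assume "degree_in j q = 0"
  then have "Poly_Mapping.lookup m j = 0" if "m \<in> Poly_Mapping.keys q" for m
    using degree_in_ge[OF that, of j] by simp
  then show "univ_in j q = [:q:]"
    by (intro univ_in_eq_const) (auto simp: in_keys_iff)
qed (simp flip: degree_univ_in)

lemma diff_ord_eqI:
  assumes "degree_in j q \<noteq> 0" "\<And>i. i > j \<Longrightarrow> degree_in i q = 0"
  shows "diff_ord q = j"
  unfolding diff_ord_def
proof (rule Max_eqI)
  show "finite (insert 0 (\<Union> (Poly_Mapping.keys ` Poly_Mapping.keys q)))" by simp
  show "i \<le> j" if i: "i \<in> insert 0 (\<Union> (Poly_Mapping.keys ` Poly_Mapping.keys q))" for i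
  proof (rule ccontr)
    assume "\<not> i \<le> j"
    then obtain m where "m \<in> Poly_Mapping.keys q" "Poly_Mapping.lookup m i \<noteq> 0"
      using i \<open>\<not> i \<le> j\<close> by (auto simp: in_keys_iff)
    then show False
      using degree_in_ge[of m q i] assms(2)[of i] \<open>\<not> i \<le> j\<close> by simp
  qed
  have "degree_in j q \<in> insert 0 ((\<lambda>m. Poly_Mapping.lookup m j) ` Poly_Mapping.keys q)"
    unfolding degree_in_def by (rule Max_in) auto
  then show "j \<in> insert 0 (\<Union> (Poly_Mapping.keys ` Poly_Mapping.keys q))"
    using assms(1) by (auto simp: in_keys_iff)
qed

definition shifts_in :: "nat set \<Rightarrow> 'a::zero mpoly \<Rightarrow> bool" where
  "shifts_in S q \<longleftrightarrow> (\<forall>j. j \<notin> S \<longrightarrow> degree_in j q = 0)"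

lemma shifts_in_mono: "shifts_in S q \<Longrightarrow> S \<subseteq> T \<Longrightarrow> shifts_in T q"
  by (auto simp: shifts_in_def)

context
  fixes S :: "nat set"
begin

lemma shifts_in_0 [simp]: "shifts_in S (0 :: 'a::comm_ring_1 mpoly)"
  by (simp add: shifts_in_def)

lemma shifts_in_Const [simp]: "shifts_in S (Const c :: 'a::comm_ring_1 mpoly)"
  by (simp add: shifts_in_def)

lemma shifts_in_Var: "j \<in> S \<Longrightarrow> shifts_in S (Var j :: 'a::comm_ring_1 mpoly)"
  by (auto simp: shifts_in_def degree_in_Var)

lemma shifts_in_add:
  "shifts_in S a \<Longrightarrow> shifts_in S b \<Longrightarrow> shifts_in S (a + b :: 'a::comm_ring_1 mpoly)"
  using degree_add_le[of "univ_in j a" 0 "univ_in j b" for j]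
  by (simp add: shifts_in_def univ_in.hom_add flip: degree_univ_in)

lemma shifts_in_diff:
  "shifts_in S a \<Longrightarrow> shifts_in S b \<Longrightarrow> shifts_in S (a - b :: 'a::comm_ring_1 mpoly)"
  using degree_diff_le[of "univ_in j a" 0 "univ_in j b" for j]
  by (simp add: shifts_in_def univ_in.hom_diff flip: degree_univ_in)

lemma shifts_in_mult:
  "shifts_in S a \<Longrightarrow> shifts_in S b \<Longrightarrow> shifts_in S (a * b :: 'a::comm_ring_1 mpoly)"
  using degree_mult_le[of "univ_in j a" "univ_in j b" for j]
  by (simp add: shifts_in_def univ_in.hom_mult flip: degree_univ_in) (metis add_0 le_zero_eq)

lemma shifts_in_sum:
  "(\<And>i. i \<in> I \<Longrightarrow> shifts_in S (f i)) \<Longrightarrow> shifts_in S (\<Sum>i\<in>I. f i :: 'a::comm_ring_1 mpoly)"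
  by (induction I rule: infinite_finite_induct) (auto intro: shifts_in_add)

definition poly_in :: "'a::comm_ring_1 mpoly poly \<Rightarrow> bool" where
  "poly_in F \<longleftrightarrow> (\<forall>i. shifts_in S (coeff F i))"

lemma poly_in_add: "poly_in F \<Longrightarrow> poly_in G \<Longrightarrow> poly_in (F + G)"
  by (simp add: poly_in_def shifts_in_add)

lemma poly_in_diff: "poly_in F \<Longrightarrow> poly_in G \<Longrightarrow> poly_in (F - G)"
  by (simp add: poly_in_def shifts_in_diff)

lemma poly_in_mult: "poly_in F \<Longrightarrow> poly_in G \<Longrightarrow> poly_in (F * G)"
  by (simp add: poly_in_def coeff_mult shifts_in_sum shifts_in_mult)

lemma poly_in_monom: "shifts_in S a \<Longrightarrow> poly_in (monom a n)"
  by (simp add: poly_in_def)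

lemma poly_in_smult: "shifts_in S a \<Longrightarrow> poly_in F \<Longrightarrow> poly_in (smult a F)"
  by (simp add: poly_in_def shifts_in_mult)

lemma poly_in_const: "shifts_in S a \<Longrightarrow> poly_in [:a:]"
  by (simp add: poly_in_monom flip: monom_0)

lemma poly_in_lift: "poly_in (map_poly Const p)"
  by (simp add: poly_in_def coeff_map_poly)

lemma poly_in_sum: "(\<And>i. i \<in> I \<Longrightarrow> poly_in (f i)) \<Longrightarrow> poly_in (\<Sum>i\<in>I. f i)"
  by (simp add: poly_in_def coeff_sum shifts_in_sum)

lemma shifts_in_poly_of_nat: "poly_in F \<Longrightarrow> shifts_in S (poly F (of_nat k))"
  unfolding poly_altdef poly_in_def
  by (intro shifts_in_sum shifts_in_mult) (auto simp: ring_homomorphism.hom_power[OF ring_homomorphism_Const, symmetric] simp flip: Const_of_nat)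

end

lemma poly_in_mono: "poly_in S F \<Longrightarrow> S \<subseteq> T \<Longrightarrow> poly_in T F"
  by (auto simp: poly_in_def intro: shifts_in_mono)

lemma poly_lift: "poly (map_poly Const p) (of_nat k) = Const (poly p (of_nat k))"
  by (induction p) (simp_all add: map_poly_pCons Const_add Const_mult Const_of_nat)

lemma subst_cong:
  assumes "shifts_in S q" "\<And>j. j \<in> S \<Longrightarrow> x j = y j"
  shows "subst_mpoly h x q = subst_mpoly h y q"
proof -
  have "x j = y j" if "m \<in> Poly_Mapping.keys q" "j \<in> Poly_Mapping.keys m" for m j
  proof (rule assms(2), rule ccontr)
    assume "j \<notin> S"
    then show False
      using that degree_in_ge[OF that(1), of j] assms(1) by (simp add: shifts_in_def in_keys_iff)
  qed
  then show ?thesis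
    unfolding subst_mpoly_def by (auto intro!: sum.cong prod.cong arg_cong2[of _ _ _ _ "(*)"])
qed

lemma subst_subst:
  fixes q :: "'a::comm_ring_1 mpoly"
  shows "subst_mpoly Const x (subst_mpoly Const y q) = subst_mpoly Const (\<lambda>j. subst_mpoly Const x (y j)) q"
  by (rule hom_eqI[OF ring_homomorphism_comp[OF Const.ring_homomorphism_subst Const.ring_homomorphism_subst]
      Const.ring_homomorphism_subst]) simp_all

lemma subst_Const_Var: "subst_mpoly Const Var q = (q :: 'a::comm_ring_1 mpoly)"
  by (rule hom_eqI) (simp_all add: Const.ring_homomorphism_subst ring_homomorphism_id)

section \<open>Total degree\<close>

text \<open>
  Multiplying every indeterminate by the new variable \<open>x\<close> grades polynomials by total degree.  As the
  map is a ring homomorphism, split by \<open>x = 1\<close>, additivity of the total degree on products comes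
  from univariate polynomials.
\<close>

definition homogenize :: "'a::comm_ring_1 mpoly \<Rightarrow> 'a mpoly poly" where
  "homogenize = subst_mpoly (\<lambda>c. [:Const c:]) (\<lambda>j. monom (Var j) 1)"

definition total_degree :: "'a::comm_ring_1 mpoly \<Rightarrow> nat" where
  "total_degree q = degree (homogenize q)"

lemma ring_homomorphism_homogenize: "ring_homomorphism homogenize"
  unfolding homogenize_def by (rule ring_homomorphism.ring_homomorphism_subst[OF ring_homomorphism_pCons_Const])

lemma homogenize_Const [simp]: "homogenize (Const c) = [:Const c:]"
  by (simp add: homogenize_def ring_homomorphism.subst_Const[OF ring_homomorphism_pCons_Const])

lemma homogenize_Var: "homogenize (Var j) = monom (Var j) 1"
  by (simp add: homogenize_def ring_homomorphism.subst_Var[OF ring_homomorphism_pCons_Const])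

lemma poly_homogenize_1: "poly (homogenize q) 1 = q"
  by (rule hom_eqI[OF ring_homomorphism_comp[OF ring_homomorphism_poly ring_homomorphism_homogenize] ring_homomorphism_id])
    (simp_all add: homogenize_Var poly_monom)

lemma poly_homogenize_0: "\<exists>c. poly (homogenize q) 0 = Const c"
proof (induction q rule: mpoly_induct)
  case (Const c)
  then show ?case by auto
next
  case (Var j)
  then show ?case by (intro exI[of _ 0]) (simp add: homogenize_Var poly_monom)
next
  case (add a b)
  then show ?case by (auto simp: ring_homomorphism.hom_add[OF ring_homomorphism_homogenize] simp flip: Const_add)
next
  case (mult a b)
  then show ?case by (auto simp: ring_homomorphism.hom_mult[OF ring_homomorphism_homogenize] simp flip: Const_mult)
qed

lemma total_degree_mult:
  fixes a b :: "'a::idom mpoly"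
  assumes "a \<noteq> 0" "b \<noteq> 0"
  shows "total_degree (a * b) = total_degree a + total_degree b"
proof -
  have "homogenize a \<noteq> 0" "homogenize b \<noteq> 0"
    using assms by (metis poly_homogenize_1 poly_0)+
  then show ?thesis
    by (simp add: total_degree_def ring_homomorphism.hom_mult[OF ring_homomorphism_homogenize] degree_mult_eq)
qed

text \<open>If \<open>x\<close> is absent, then the substitutions \<open>x = 1\<close> and \<open>x = 0\<close> agree.\<close>

lemma total_degree_0_imp_Const:
  assumes "total_degree q = 0"
  shows "\<exists>c. q = Const c"
proof -
  obtain a where "homogenize q = [:a:]"
    using assms by (auto simp: total_degree_def elim: degree_eq_zeroE)
  then show ?thesis
    using poly_homogenize_0[of q] poly_homogenize_1[of q] by simp
qed

section \<open>The dichotomy along a generic solution\<close>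

text \<open>
  \<open>M\<close> is the first index \<open>N + 1\<close> of the generic solution.  The solution is polynomial in the initial
  terms, since only leading coefficients in K are ever divided by; hence \<open>E\<close> takes its values in
  the polynomial ring.  When the trailing coefficients below \<open>t\<close> vanish, the recurrence does not
  relate \<open>e(n), ..., e(n+t-1)\<close> to later terms, and everything is done with the shifts from \<open>t\<close> on.
\<close>

locale generic_recurrence =
  fixes P :: "nat \<Rightarrow> 'a::field_char_0 poly" and t l M :: nat and E :: "nat \<Rightarrow> 'a mpoly"
  assumes t_le_l: "t \<le> l"
    and trail: "\<And>k. k \<ge> M \<Longrightarrow> poly (P t) (of_nat k) \<noteq> 0"
    and lead: "\<And>k. k \<ge> M \<Longrightarrow> poly (P l) (of_nat k) \<noteq> 0"
    and init: "\<And>j. j < l \<Longrightarrow> E (M + j) = Var (Suc j)"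
    and rec: "\<And>k. k \<ge> M \<Longrightarrow> (\<Sum>i\<in>{t..l}. Const (poly (P i) (of_nat k)) * E (k + i)) = 0"
begin

definition ev :: "nat \<Rightarrow> 'a mpoly \<Rightarrow> 'a mpoly" where
  "ev k = subst_mpoly Const (\<lambda>j. E (k + j))"

lemma ring_homomorphism_ev: "ring_homomorphism (ev k)"
  unfolding ev_def by (rule Const.ring_homomorphism_subst)

sublocale ev: ring_homomorphism "ev k" for k
  by (rule ring_homomorphism_ev)

lemma ev_Const [simp]: "ev k (Const c) = Const c"
  by (simp add: ev_def)

lemma ev_Var [simp]: "ev k (Var j) = E (k + j)"
  by (simp add: ev_def)

text \<open>
  Algebraic independence of \<open>E(k+t), ..., E(k+l-1)\<close>, in the form of a left inverse.  At \<open>k = M\<close>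
  these terms are themselves indeterminates.  From \<open>k\<close> to \<open>k + 1\<close> the window moves by one place:
  \<open>E(k+t)\<close> leaves and \<open>E(k+l)\<close> enters, and the recurrence at \<open>k\<close>, solved for \<open>E(k+t)\<close>, expresses
  the old window in terms of the new one because \<open>P t\<close> has no root there.
\<close>

lemma inverse_substitution:
  assumes "k \<ge> M"
  shows "\<exists>w. \<forall>j\<in>{t..<l}. subst_mpoly Const w (E (k + j)) = Var j"
  using assms
proof (induction k rule: nat_induct_at_least)
  case base
  show ?case
    by (rule exI[of _ "\<lambda>j. Var (j - 1)"]) (simp add: init)
next
  case (Suc k)
  then obtain w where w: "\<And>j. j \<in> {t..<l} \<Longrightarrow> subst_mpoly Const w (E (k + j)) = Var j"
    by blast
  let ?c = "\<lambda>i. poly (P i) (of_nat k)"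
  \<comment> \<open>the old window, expressed in the indeterminates that stand for the new one\<close>
  define z where "z = (\<lambda>j. if j = t
    then Const (- 1 / ?c t) * (\<Sum>i\<in>{t<..l}. Const (?c i) * Var (i - 1)) else Var (j - 1))"
  define \<phi> where "\<phi> = subst_mpoly Const (\<lambda>i. subst_mpoly Const z (w i))"
  interpret \<phi>: ring_homomorphism \<phi>
    unfolding \<phi>_def by (rule Const.ring_homomorphism_subst)
  have \<phi>_eq: "\<phi> f = subst_mpoly Const z (subst_mpoly Const w f)" for f
    by (simp add: \<phi>_def subst_subst)
  have \<phi>E: "\<phi> (E (k + i)) = z i" if "i \<in> {t..<l}" for i
    using that by (simp add: \<phi>_eq w)
  have last: "\<phi> (E (k + l)) = Var (l - 1)" if "t < l"
  proof -
    have "0 = \<phi> (\<Sum>i\<in>{t..l}. Const (?c i) * E (k + i))"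
      using rec Suc by simp
    also have "\<dots> = (\<Sum>i\<in>{t..l}. Const (?c i) * \<phi> (E (k + i)))"
      by (simp add: \<phi>.hom_sum \<phi>.hom_mult) (simp add: \<phi>_def)
    also have "{t..l} = insert t (insert l {t<..<l})"
      using that by auto
    also have "(\<Sum>i\<in>insert t (insert l {t<..<l}). Const (?c i) * \<phi> (E (k + i))) =
        Const (?c t) * z t + Const (?c l) * \<phi> (E (k + l)) + (\<Sum>i\<in>{t<..<l}. Const (?c i) * Var (i - 1))"
      using that by (simp add: \<phi>E z_def)
    also have "Const (?c t) * z t = - (\<Sum>i\<in>{t<..l}. Const (?c i) * Var (i - 1))"
      using trail[of k] Suc unfolding z_def
      by (simp add: mult.assoc[symmetric] Const_mult[symmetric]) (simp add: Const.hom_uminus)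
    also have "{t<..l} = insert l {t<..<l}"
      using that by auto
    finally have "Const (?c l) * (\<phi> (E (k + l)) - Var (l - 1)) = 0"
      by (auto simp: algebra_simps)
    then show ?thesis using lead[of k] Suc by (metis Const_eq_0_iff mult_eq_0_iff eq_iff_diff_eq_0)
  qed
  have "\<phi> (E (Suc k + j)) = Var j" if "j \<in> {t..<l}" for j
  proof (cases "Suc j = l")
    case True
    then show ?thesis using last that by auto
  next
    case False
    then show ?thesis using \<phi>E[of "Suc j"] that by (simp add: z_def)
  qed
  then show ?case unfolding \<phi>_def by blast
qed

lemma ev_neq_0:
  assumes "k \<ge> M" "shifts_in {t..<l} f" "f \<noteq> 0"
  shows "ev k f \<noteq> 0"
proof -
  obtain w where w: "\<And>j. j \<in> {t..<l} \<Longrightarrow> subst_mpoly Const w (E (k + j)) = Var j"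
    using inverse_substitution assms(1) by blast
  have "subst_mpoly Const w (ev k f) = subst_mpoly Const Var f"
    unfolding ev_def subst_subst using assms(2) by (rule subst_cong) (rule w)
  then have "subst_mpoly Const w (ev k f) = f"
    by (simp add: subst_Const_Var)
  then show ?thesis using assms(3) ring_homomorphism.hom_0[OF Const.ring_homomorphism_subst] by metis
qed

definition val :: "nat \<Rightarrow> 'a mpoly poly \<Rightarrow> 'a mpoly" where
  "val k F = ev k (poly F (of_nat k))"

lemma val_add: "val k (F + G) = val k F + val k G"
  by (simp add: val_def ev.hom_add)

lemma val_diff: "val k (F - G) = val k F - val k G"
  by (simp add: val_def ev.hom_diff)

lemma val_mult: "val k (F * G) = val k F * val k G"
  by (simp add: val_def ev.hom_mult)

lemma val_smult: "val k (smult a F) = ev k a * val k F"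
  by (simp add: val_def ev.hom_mult)

lemma val_sum: "val k (\<Sum>i\<in>I. f i) = (\<Sum>i\<in>I. val k (f i))"
  by (simp add: val_def poly_sum ev.hom_sum)

lemma val_lift: "val k (map_poly Const p) = Const (poly p (of_nat k))"
  by (simp add: val_def poly_lift)

lemma val_const: "val k [:a:] = ev k a"
  by (simp add: val_def)

lemma val_0 [simp]: "val k 0 = 0"
  by (simp add: val_def)

lemma val_altdef: "val k F = (\<Sum>i\<le>degree F. ev k (coeff F i) * of_nat k ^ i)"
  by (simp add: val_def poly_altdef ev.hom_sum ev.hom_mult ev.hom_power ev.hom_of_nat)

text \<open>
  Sequences that the recurrence brings to normal form: after clearing a denominator in K[n] without
  roots from \<open>M\<close> on, they are polynomial in the index and in the algebraically independent terms
  \<open>E(k+t), ..., E(k+l-1)\<close>.  They form a ring that contains every \<open>E(k+j)\<close> with \<open>j \<ge> t\<close>, hence all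
  values along \<open>E\<close> of polynomials in the shifts from \<open>t\<close> on.
\<close>

definition tame :: "(nat \<Rightarrow> 'a mpoly) \<Rightarrow> bool" where
  "tame \<phi> \<longleftrightarrow> (\<exists>c F. poly_in {t..<l} F \<and>
    (\<forall>k\<ge>M. poly c (of_nat k) \<noteq> 0 \<and> Const (poly c (of_nat k)) * \<phi> k = val k F))"

lemma tame_val:
  assumes "poly_in {t..<l} F"
  shows "tame (\<lambda>k. val k F)"
  unfolding tame_def using assms by (intro exI[of _ 1] exI[of _ F]) simp

lemma tame_lift: "tame (\<lambda>k. Const (poly p (of_nat k)))"
  using tame_val[OF poly_in_lift, of p] by (simp add: val_lift)

lemma tame_add:
  assumes "tame \<phi>" "tame \<psi>"
  shows "tame (\<lambda>k. \<phi> k + \<psi> k)"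
proof -
  obtain c F where F: "poly_in {t..<l} F"
    and F': "\<And>k. k \<ge> M \<Longrightarrow> poly c (of_nat k) \<noteq> 0 \<and> Const (poly c (of_nat k)) * \<phi> k = val k F"
    using assms(1) unfolding tame_def by blast
  obtain d G where G: "poly_in {t..<l} G"
    and G': "\<And>k. k \<ge> M \<Longrightarrow> poly d (of_nat k) \<noteq> 0 \<and> Const (poly d (of_nat k)) * \<psi> k = val k G"
    using assms(2) unfolding tame_def by blast
  show ?thesis
    unfolding tame_def
  proof (intro exI[of _ "c * d"] exI[of _ "map_poly Const d * F + map_poly Const c * G"] conjI allI impI)
    show "poly_in {t..<l} (map_poly Const d * F + map_poly Const c * G)"
      by (intro poly_in_add poly_in_mult poly_in_lift F G)
    fix k assume "k \<ge> M"
    then show "poly (c * d) (of_nat k) \<noteq> 0" using F' G' by simp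
    show "Const (poly (c * d) (of_nat k)) * (\<phi> k + \<psi> k) =
        val k (map_poly Const d * F + map_poly Const c * G)"
      using F'[OF \<open>k \<ge> M\<close>] G'[OF \<open>k \<ge> M\<close>]
      by (simp add: val_add val_mult val_lift Const_mult flip: F' G')
        (simp add: algebra_simps)
  qed
qed

lemma tame_mult:
  assumes "tame \<phi>" "tame \<psi>"
  shows "tame (\<lambda>k. \<phi> k * \<psi> k)"
proof -
  obtain c F where F: "poly_in {t..<l} F"
    and F': "\<And>k. k \<ge> M \<Longrightarrow> poly c (of_nat k) \<noteq> 0 \<and> Const (poly c (of_nat k)) * \<phi> k = val k F"
    using assms(1) unfolding tame_def by blast
  obtain d G where G: "poly_in {t..<l} G"
    and G': "\<And>k. k \<ge> M \<Longrightarrow> poly d (of_nat k) \<noteq> 0 \<and> Const (poly d (of_nat k)) * \<psi> k = val k G"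
    using assms(2) unfolding tame_def by blast
  show ?thesis
    unfolding tame_def
  proof (intro exI[of _ "c * d"] exI[of _ "F * G"] conjI allI impI)
    show "poly_in {t..<l} (F * G)"
      by (intro poly_in_mult F G)
    fix k assume "k \<ge> M"
    then show "poly (c * d) (of_nat k) \<noteq> 0" using F' G' by simp
    show "Const (poly (c * d) (of_nat k)) * (\<phi> k * \<psi> k) = val k (F * G)"
      using F'[OF \<open>k \<ge> M\<close>] G'[OF \<open>k \<ge> M\<close>]
      by (simp add: val_mult Const_mult flip: F' G')
        (simp add: algebra_simps)
  qed
qed

lemma tame_sum: "(\<And>i. i \<in> I \<Longrightarrow> tame (\<phi> i)) \<Longrightarrow> tame (\<lambda>k. \<Sum>i\<in>I. \<phi> i k)"
proof (induction I rule: infinite_finite_induct)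
  case (insert i I)
  then show ?case using tame_add[of "\<phi> i" "\<lambda>k. \<Sum>i\<in>I. \<phi> i k"] by simp
qed (use tame_lift[of 0] in simp_all)

lemma tame_cancel:
  assumes "tame (\<lambda>k. Const (poly p (of_nat k)) * \<phi> k)" "\<And>k. k \<ge> M \<Longrightarrow> poly p (of_nat k) \<noteq> 0"
  shows "tame \<phi>"
proof -
  obtain c F where "poly_in {t..<l} F" "\<And>k. k \<ge> M \<Longrightarrow> poly c (of_nat k) \<noteq> 0 \<and>
      Const (poly c (of_nat k)) * (Const (poly p (of_nat k)) * \<phi> k) = val k F"
    using assms(1) unfolding tame_def by blast
  then show ?thesis
    unfolding tame_def using assms(2)
    by (intro exI[of _ "c * p"] exI[of _ F]) (simp add: Const_mult mult.assoc)
qed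

lemma shift_rec:
  assumes "k \<ge> M"
  shows "(\<Sum>i\<in>{t..<l}. Const (poly (P i) (of_nat (k + j))) * E (k + j + i)) +
    Const (poly (P l) (of_nat (k + j))) * E (k + j + l) = 0"
proof -
  have "{t..l} = insert l {t..<l}" using t_le_l by auto
  then show ?thesis using rec[of "k + j"] assms by (simp add: add.commute)
qed

lemma poly_shift: "poly (pcompose p [:of_nat j, 1:]) (of_nat k) = poly p (of_nat (k + j))"
  by (simp add: poly_pcompose add.commute)

text \<open>Beyond the window, the recurrence reduces \<open>E(k+j)\<close> to terms with smaller \<open>j\<close>.\<close>

lemma tame_term:
  assumes "j \<ge> t"
  shows "tame (\<lambda>k. E (k + j))"
  using assms
proof (induction j rule: less_induct)
  case (less j)
  show ?case
  proof (cases "j < l")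
    case True
    then show ?thesis
      using tame_val[OF poly_in_const[OF shifts_in_Var], of j] less.prems by (simp add: val_const)
  next
    case False
    then obtain i where j: "j = l + i" using le_Suc_ex not_less by blast
    let ?p = "\<lambda>r. pcompose (P r) [:of_nat i, 1:]"
    have "tame (\<lambda>k. \<Sum>r\<in>{t..<l}. Const (poly (?p r) (of_nat k)) * E (k + (i + r)))"
      by (intro tame_sum tame_mult tame_lift less.IH) (use j t_le_l in auto)
    from tame_mult[OF tame_lift[of "- 1"] this]
    have "tame (\<lambda>k. - (\<Sum>r\<in>{t..<l}. Const (poly (?p r) (of_nat k)) * E (k + (i + r))))"
      by (simp add: Const.hom_uminus)
    then have "tame (\<lambda>k. Const (poly (?p l) (of_nat k)) * E (k + j))"
      unfolding tame_def
    proof (elim exE conjE, intro exI conjI)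
      fix c F
      assume *: "\<forall>k\<ge>M. poly c (of_nat k) \<noteq> 0 \<and> Const (poly c (of_nat k)) *
          - (\<Sum>r\<in>{t..<l}. Const (poly (?p r) (of_nat k)) * E (k + (i + r))) = val k F"
      have "Const (poly (?p l) (of_nat k)) * E (k + j) =
          - (\<Sum>r\<in>{t..<l}. Const (poly (?p r) (of_nat k)) * E (k + (i + r)))" if "k \<ge> M" for k
        using shift_rec[OF that, of i] unfolding poly_shift j
        by (simp add: eq_neg_iff_add_eq_0 ac_simps)
      then show "\<forall>k\<ge>M. poly c (of_nat k) \<noteq> 0 \<and> Const (poly c (of_nat k)) *
          (Const (poly (?p l) (of_nat k)) * E (k + j)) = val k F"
        using * by simp
    qed
    then show ?thesis
      by (rule tame_cancel) (use lead in \<open>simp add: poly_shift del: of_nat_add\<close>)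
  qed
qed

lemma tame_ev:
  assumes "shifts_in {t..} f"
  shows "tame (\<lambda>k. ev k f)"
proof -
  \<comment> \<open>the shifts below \<open>t\<close> may be sent to \<open>0\<close>, which opens the way to induction on all polynomials\<close>
  have "tame (\<lambda>k. subst_mpoly Const (\<lambda>j. if t \<le> j then E (k + j) else 0) f)"
  proof (induction f rule: mpoly_induct)
    case (Const c)
    then show ?case using tame_lift[of "[:c:]"] by simp
  next
    case (Var j)
    then show ?case using tame_term[of j] tame_lift[of 0] by (cases "t \<le> j") simp_all
  next
    case (add a b)
    then show ?case using tame_add by (simp add: Const.subst_add)
  next
    case (mult a b)
    then show ?case using tame_mult by (simp add: Const.subst_mult)
  qed
  also have "(\<lambda>k. subst_mpoly Const (\<lambda>j. if t \<le> j then E (k + j) else 0) f) = (\<lambda>k. ev k f)"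
    unfolding ev_def by (intro ext subst_cong[OF assms]) simp
  finally show ?thesis .
qed

definition vanishing :: "'a mpoly \<Rightarrow> bool" where
  "vanishing f \<longleftrightarrow> (\<forall>k\<ge>M. ev k f = 0)"

text \<open>
  If the normal form is the zero polynomial, all values vanish.  Otherwise, by algebraic
  independence, a value can vanish only at one of the finitely many roots of the normal form as a
  polynomial in the index over the domain \<open>'a mpoly\<close>.
\<close>

lemma vanishing_or_eventually_nonzero:
  assumes "shifts_in {t..} f"
  shows "vanishing f \<or> (\<forall>\<^sub>F k in sequentially. ev k f \<noteq> 0)"
proof -
  obtain c F where F: "poly_in {t..<l} F"
    and F': "\<And>k. k \<ge> M \<Longrightarrow> poly c (of_nat k) \<noteq> 0 \<and> Const (poly c (of_nat k)) * ev k f = val k F"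
    using tame_ev[OF assms] unfolding tame_def by blast
  show ?thesis
  proof (cases "F = 0")
    case True
    then have "vanishing f" using F' by (auto simp: vanishing_def)
    then show ?thesis ..
  next
    case False
    then have "finite {x. poly F x = 0}" by (rule poly_roots_finite)
    then have "finite (of_nat -` {x. poly F x = 0} :: nat set)"
      by (rule finite_vimageI) (simp add: inj_on_def)
    then have "\<forall>\<^sub>F k in sequentially. poly F (of_nat k) \<noteq> 0"
      by (simp add: eventually_cofinite vimage_def flip: cofinite_eq_sequentially)
    then have "\<forall>\<^sub>F k in sequentially. ev k f \<noteq> 0"
      using eventually_ge_at_top[of M]
    proof eventually_elim
      case (elim k)
      then have "val k F \<noteq> 0"
        unfolding val_def by (intro ev_neq_0 shifts_in_poly_of_nat F)
      then show ?case using F'[of k] elim by auto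
    qed
    then show ?thesis ..
  qed
qed

section \<open>Descent on the degree of an annihilator of the index\<close>

lemma vanishing_coeffs_imp_val_0:
  assumes "\<And>i. vanishing (coeff F i)" "k \<ge> M"
  shows "val k F = 0"
  using assms by (simp add: val_altdef vanishing_def)

text \<open>Modulo the ideal of vanishing polynomials, \<open>s(n+j)\<close> is a rational function of earlier shifts.\<close>

definition rational_at :: "nat \<Rightarrow> bool" where
  "rational_at j \<longleftrightarrow> (\<exists>u v. shifts_in {t..<j} u \<and> shifts_in {t..<j} v \<and>
    \<not> vanishing v \<and> vanishing (u + Var j * v))"

text \<open>
  Eventual nonvanishing of \<open>V\<close> at the index is the statement that \<open>V(n)\<close> is nonzero in the field in
  which \<open>n\<close> is algebraic; unlike nonvanishing of the polynomial \<open>V\<close>, it survives reduction modulo an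
  annihilator of \<open>n\<close>.
\<close>

definition linear_relation :: "nat \<Rightarrow> 'a mpoly poly \<Rightarrow> 'a mpoly poly \<Rightarrow> bool" where
  "linear_relation m U V \<longleftrightarrow> poly_in {t..<m} U \<and> poly_in {t..<m} V \<and>
    (\<forall>k\<ge>M. val k (U + smult (Var m) V) = 0) \<and> (\<forall>\<^sub>F k in sequentially. val k V \<noteq> 0)"

lemma shifted_recurrence_linear_relation:
  assumes "m \<ge> l" "\<And>i. i \<le> l \<Longrightarrow> degree (P i) \<le> d"
  shows "\<exists>U V. linear_relation m U V \<and> degree U \<le> d \<and> degree V \<le> d"
proof -
  obtain s where m: "m = l + s" using assms(1) le_Suc_ex by blast
  let ?p = "\<lambda>i. map_poly Const (pcompose (P i) [:of_nat s, 1:])"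
  define U where "U = (\<Sum>i\<in>{t..<l}. smult (Var (s + i)) (?p i))"
  have "poly_in {t..<m} U"
    unfolding U_def by (intro poly_in_sum poly_in_smult shifts_in_Var poly_in_lift) (auto simp: m)
  moreover have "poly_in {t..<m} (?p l)" by (rule poly_in_lift)
  moreover have "val k (U + smult (Var m) (?p l)) = 0" if "k \<ge> M" for k
    using shift_rec[OF that, of s]
    by (simp add: U_def val_add val_sum val_smult val_lift poly_shift m ac_simps del: of_nat_add)
  moreover have "\<forall>\<^sub>F k in sequentially. val k (?p l) \<noteq> 0"
    using eventually_ge_at_top[of M]
    by eventually_elim (simp add: val_lift poly_shift lead del: of_nat_add)
  moreover have deg: "degree (?p i) \<le> d" if "i \<le> l" for i
    using assms(2)[OF that] map_poly_degree_leq[of Const "pcompose (P i) [:of_nat s, 1:]"]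
    by (simp add: degree_pcompose)
  moreover have "degree U \<le> d"
    unfolding U_def by (intro degree_sum_le order.trans[OF degree_smult_le] deg) auto
  ultimately show ?thesis
    unfolding linear_relation_def by (intro exI[of _ U] exI[of _ "?p l"]) auto
qed

lemma degree_cancel_leading:
  fixes U :: "'a mpoly poly"
  assumes "degree U \<le> D" "degree g \<le> D" "D > 0"
  shows "degree (smult (lead_coeff g) U - monom (coeff U D) (D - degree g) * g) < D"
proof -
  let ?W = "smult (lead_coeff g) U - monom (coeff U D) (D - degree g) * g"
  have "coeff ?W i = 0" if "i \<ge> D" for i
  proof (cases "i = D")
    case True
    then show ?thesis using assms(2) by (simp add: coeff_monom_mult)
  next
    case False
    then have "i - (D - degree g) > degree g" using assms that by linarith
    then show ?thesis using False that assms(1) by (simp add: coeff_monom_mult coeff_eq_0)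
  qed
  then have "degree ?W \<le> D - 1" by (intro degree_le) simp
  then show ?thesis using assms(3) by simp
qed

text \<open>
  One step of pseudo-division multiplies \<open>U\<close> and \<open>V\<close> by the same leading coefficient and subtracts
  multiples of \<open>g\<close>, whose values are zero.  The values of both are scaled by the same factor, so the
  relation persists, and \<open>V\<close> stays eventually nonzero by the dichotomy for this factor.
\<close>

lemma reduce_linear_relation:
  assumes g: "poly_in {t..<m} g" "\<And>k. k \<ge> M \<Longrightarrow> val k g = 0" "\<not> vanishing (lead_coeff g)" "degree g > 0"
    and "linear_relation m U V" "degree U \<le> D" "degree V \<le> D"
  shows "\<exists>U V. linear_relation m U V \<and> degree U < degree g \<and> degree V < degree g"
  using assms(5-7)
proof (induction D arbitrary: U V rule: less_induct)
  case (less D)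
  show ?case
  proof (cases "D < degree g")
    case True
    then show ?thesis using less.prems by (meson le_less_trans)
  next
    case False
    define red where "red W = smult (lead_coeff g) W - monom (coeff W D) (D - degree g) * g" for W
    have UV: "poly_in {t..<m} U" "poly_in {t..<m} V" "\<And>k. k \<ge> M \<Longrightarrow> val k (U + smult (Var m) V) = 0"
      "\<forall>\<^sub>F k in sequentially. val k V \<noteq> 0"
      using less.prems(1) by (auto simp: linear_relation_def)
    have poly_in_red: "poly_in {t..<m} (red W)" if "poly_in {t..<m} W" for W
      using that g(1) unfolding red_def
      by (intro poly_in_diff poly_in_smult poly_in_mult poly_in_monom) (auto simp: poly_in_def)
    have val_red: "val k (red W) = ev k (lead_coeff g) * val k W" if "k \<ge> M" for k W
      using g(2)[OF that] by (simp add: red_def val_diff val_smult val_mult)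
    have "shifts_in {t..} (lead_coeff g)"
      using g(1) by (auto simp: poly_in_def intro: shifts_in_mono)
    then have "\<forall>\<^sub>F k in sequentially. ev k (lead_coeff g) \<noteq> 0"
      using vanishing_or_eventually_nonzero g(3) by blast
    then have nz: "\<forall>\<^sub>F k in sequentially. val k (red V) \<noteq> 0"
      using UV(4) eventually_ge_at_top[of M]
      by eventually_elim (simp add: val_red)
    have "val k (red U + smult (Var m) (red V)) = 0" if "k \<ge> M" for k
    proof -
      have "val k (red U + smult (Var m) (red V)) = ev k (lead_coeff g) * val k (U + smult (Var m) V)"
        by (simp add: val_add val_smult val_red[OF that] algebra_simps)
      then show ?thesis using UV(3)[OF that] by simp
    qed
    with nz UV(1,2) have "linear_relation m (red U) (red V)"
      by (simp add: linear_relation_def poly_in_red)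
    moreover have "degree (red U) < D" "degree (red V) < D"
      using False g(4) less.prems(2,3) unfolding red_def
      by (intro degree_cancel_leading; simp)+
    then have "degree (red U) \<le> D - 1" "degree (red V) \<le> D - 1" "D - 1 < D" by auto
    ultimately show ?thesis using less.IH by blast
  qed
qed

text \<open>
  Either every coefficient of \<open>U + s(n+m) V\<close> vanishes along the solution, and one for which the
  coefficient of \<open>V\<close> does not vanish can be solved for \<open>s(n+m)\<close>; or the polynomial is a nontrivial
  annihilator of the index over the shifts up to \<open>m\<close>.
\<close>

lemma linear_relation_cases:
  assumes "linear_relation m U V" "t \<le> m"
  obtains "rational_at m"
  | i where "\<not> vanishing (coeff (U + smult (Var m) V) i)"
    "poly_in {t..<Suc m} (U + smult (Var m) V)" "\<And>k. k \<ge> M \<Longrightarrow> val k (U + smult (Var m) V) = 0"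
proof (cases "\<forall>i. vanishing (coeff (U + smult (Var m) V) i)")
  case True
  have "\<exists>i. \<not> vanishing (coeff V i)"
  proof (rule ccontr)
    assume "\<nexists>i. \<not> vanishing (coeff V i)"
    then have "\<forall>\<^sub>F k in sequentially. val k V = 0"
      using vanishing_coeffs_imp_val_0 by (intro eventually_sequentiallyI[of M]) blast
    moreover have "\<forall>\<^sub>F k in sequentially. val k V \<noteq> 0"
      using assms(1) by (simp add: linear_relation_def)
    ultimately have "\<forall>\<^sub>F k :: nat in sequentially. False"
      by eventually_elim simp
    then show False by simp
  qed
  then obtain i where "\<not> vanishing (coeff V i)" by blast
  then have "rational_at m"
    unfolding rational_at_def using True assms(1)
    by (intro exI[of _ "coeff U i"] exI[of _ "coeff V i"]) (auto simp: linear_relation_def poly_in_def)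
  then show ?thesis by (rule that(1))
next
  case False
  then obtain i where "\<not> vanishing (coeff (U + smult (Var m) V) i)" by blast
  moreover have "poly_in {t..<Suc m} (U + smult (Var m) V)"
    using assms unfolding linear_relation_def
    by (intro poly_in_add poly_in_smult shifts_in_Var) (auto elim: poly_in_mono)
  ultimately show ?thesis
    using assms(1) by (intro that(2)) (auto simp: linear_relation_def)
qed

text \<open>
  Each round trades an annihilator over the shifts before \<open>m\<close> for one of smaller degree over the
  shifts up to \<open>m\<close>, so at most \<open>degree g\<close> rounds are possible.  A leading coefficient that vanishes
  along the solution is dropped first, since pseudo-division by it would lose the relation.
\<close>

lemma annihilator_imp_rational_at:
  assumes deg: "\<And>i. i \<le> l \<Longrightarrow> degree (P i) \<le> d"
    and "m \<ge> l" "poly_in {t..<m} g" "\<And>k. k \<ge> M \<Longrightarrow> val k g = 0" "\<not> vanishing (coeff g i)"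
  shows "\<exists>j\<ge>m. j < m + degree g \<and> rational_at j"
  using assms(2-)
proof (induction "degree g" arbitrary: m g i rule: less_induct)
  case less
  have deg_pos: "degree g > 0"
  proof (rule ccontr)
    assume "\<not> degree g > 0"
    then obtain a where g: "g = [:a:]" by (auto elim: degree_eq_zeroE)
    then have "vanishing (coeff g i)"
      using less.prems(3) by (auto simp: val_const vanishing_def coeff_pCons split: nat.split)
    then show False using less.prems(4) by blast
  qed
  show ?case
  proof (cases "vanishing (lead_coeff g)")
    case True
    define h where "h = g - monom (lead_coeff g) (degree g)"
    have "coeff h r = 0" if "r \<ge> degree g" for r
      using that by (cases "r = degree g") (simp_all add: h_def coeff_eq_0)
    then have "degree h \<le> degree g - 1" by (intro degree_le) simp
    then have deg_h: "degree h < degree g" using deg_pos by simp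
    have "poly_in {t..<m} h"
      unfolding h_def using less.prems(2) by (intro poly_in_diff poly_in_monom) (auto simp: poly_in_def)
    moreover have "val k h = 0" if "k \<ge> M" for k
    proof -
      have "val k (monom (lead_coeff g) (degree g)) = 0"
        using True that by (simp add: val_def poly_monom ev.hom_mult vanishing_def)
      then show ?thesis using less.prems(3)[OF that] by (simp add: h_def val_diff)
    qed
    moreover have "\<not> vanishing (coeff h i)"
      using less.prems(4) True by (cases "i = degree g") (simp_all add: h_def)
    ultimately obtain j where "j \<ge> m" "j < m + degree h" "rational_at j"
      using less.hyps[OF deg_h less.prems(1)] by blast
    then show ?thesis using deg_h by (intro exI[of _ j]) auto
  next
    case False
    obtain U' V' where "linear_relation m U' V'" "degree U' \<le> d" "degree V' \<le> d"
      using shifted_recurrence_linear_relation[OF less.prems(1) deg] by blast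
    then obtain U V where UV: "linear_relation m U V" "degree U < degree g" "degree V < degree g"
      using reduce_linear_relation[OF less.prems(2,3) False deg_pos] by blast
    let ?h = "U + smult (Var m) V"
    have deg_h: "degree ?h < degree g"
      using UV by (intro degree_add_less le_less_trans[OF degree_smult_le])
    have "t \<le> m" using t_le_l less.prems(1) by simp
    from UV(1) this show ?thesis
    proof (cases rule: linear_relation_cases)
      case 1
      then show ?thesis using deg_pos by (intro exI[of _ m]) simp
    next
      case (2 i)
      then obtain j where "j \<ge> Suc m" "j < Suc m + degree ?h" "rational_at j"
        using less.hyps[OF deg_h, of "Suc m"] less.prems(1) by (metis le_SucI)
      then show ?thesis using deg_h by (intro exI[of _ j]) auto
    qed
  qed
qed

text \<open>
  The unshifted recurrence is the first annihilator; it involves the shifts up to \<open>l\<close> and has degree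
  at most \<open>d\<close>, which leads to the bound \<open>l + d\<close>.
\<close>

lemma ex_rational_at:
  assumes deg: "\<And>i. i \<le> l \<Longrightarrow> degree (P i) \<le> d"
  shows "\<exists>j. l \<le> j \<and> j \<le> l + d \<and> rational_at j"
proof -
  obtain U V where UV: "linear_relation l U V" "degree U \<le> d" "degree V \<le> d"
    using shifted_recurrence_linear_relation[OF order.refl deg] by blast
  let ?g = "U + smult (Var l) V"
  have deg_g: "degree ?g \<le> d"
    using UV by (intro degree_add_le order.trans[OF degree_smult_le])
  from UV(1) t_le_l show ?thesis
  proof (cases rule: linear_relation_cases)
    case 1
    then show ?thesis by (intro exI[of _ l]) simp
  next
    case (2 i)
    then obtain j where "j \<ge> Suc l" "j < Suc l + degree ?g" "rational_at j"
      using annihilator_imp_rational_at[OF deg, of "Suc l" ?g i] by auto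
    then show ?thesis using deg_g by (intro exI[of _ j]) auto
  qed
qed

section \<open>An irreducible solution\<close>

definition solves_for :: "nat \<Rightarrow> 'a mpoly \<Rightarrow> bool" where
  "solves_for j q \<longleftrightarrow> shifts_in {t..j} q \<and> degree_in j q = 1 \<and> vanishing q \<and>
    (\<forall>\<^sub>F k in sequentially. ev k (coeff_in j 1 q) \<noteq> 0)"

lemma rational_at_imp_solves_for:
  assumes "rational_at j" "t \<le> j"
  shows "\<exists>q. solves_for j q"
proof -
  obtain u v where uv: "shifts_in {t..<j} u" "shifts_in {t..<j} v" "\<not> vanishing v"
    "vanishing (u + Var j * v)"
    using assms(1) unfolding rational_at_def by blast
  let ?q = "u + Var j * v"
  have "v \<noteq> 0" using uv(3) by (auto simp: vanishing_def)
  have "univ_in j u = [:u:]" "univ_in j v = [:v:]"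
    using uv(1,2) by (auto simp: univ_in_eq_const_iff shifts_in_def)
  then have "univ_in j ?q = [:u, v:]"
    by (simp add: univ_in.hom_add univ_in.hom_mult univ_in_Var)
  with \<open>v \<noteq> 0\<close> have "degree_in j ?q = 1" "coeff_in j 1 ?q = v"
    by (simp_all flip: degree_univ_in coeff_univ_in)
  moreover have "shifts_in {t..j} ?q"
    using uv(1,2) assms(2) by (intro shifts_in_add shifts_in_mult shifts_in_Var)
      (auto elim: shifts_in_mono)
  moreover have "\<forall>\<^sub>F k in sequentially. ev k v \<noteq> 0"
  proof -
    have "shifts_in {t..} v" using uv(2) by (rule shifts_in_mono) auto
    then show ?thesis using vanishing_or_eventually_nonzero uv(3) by blast
  qed
  ultimately show ?thesis using uv(4) unfolding solves_for_def by metis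
qed

text \<open>
  The leading coefficient of \<open>a * b\<close> in \<open>s(n+j)\<close> is \<open>a\<close> times that of \<open>b\<close>, so \<open>a\<close> is eventually
  nonzero along the solution.  Hence \<open>b\<close> vanishes at large indices, and by the dichotomy everywhere.
\<close>

lemma solves_for_factor:
  assumes "solves_for j (a * b)" "degree_in j a = 0"
  shows "solves_for j b"
proof -
  have ab: "a * b \<noteq> 0" using assms(1) by (auto simp: solves_for_def)
  then have deg: "degree_in i (a * b) = degree_in i a + degree_in i b" for i
    by (intro degree_in_mult) auto
  have "shifts_in {t..j} b"
    using assms(1) by (simp add: solves_for_def shifts_in_def deg)
  moreover have "degree_in j b = 1"
    using assms by (simp add: solves_for_def deg)
  moreover have "univ_in j a = [:a:]"
    using assms(2) by (simp add: univ_in_eq_const_iff)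
  then have "coeff_in j 1 (a * b) = a * coeff_in j 1 b"
    by (simp add: univ_in.hom_mult flip: coeff_univ_in)
  then have nz: "\<forall>\<^sub>F k in sequentially. ev k a * ev k (coeff_in j 1 b) \<noteq> 0"
    using assms(1) by (simp add: solves_for_def ev.hom_mult)
  then have "\<forall>\<^sub>F k in sequentially. ev k (coeff_in j 1 b) \<noteq> 0"
    by eventually_elim simp
  moreover have "vanishing b"
  proof (rule ccontr)
    assume "\<not> vanishing b"
    moreover have "shifts_in {t..} b"
      using \<open>shifts_in {t..j} b\<close> by (rule shifts_in_mono) auto
    ultimately have "\<forall>\<^sub>F k in sequentially. ev k b \<noteq> 0"
      using vanishing_or_eventually_nonzero by blast
    with nz have "\<forall>\<^sub>F k in sequentially. False"
      using eventually_ge_at_top[of M]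
    proof eventually_elim
      case (elim k)
      then have "ev k (a * b) = 0" using assms(1) by (simp add: solves_for_def vanishing_def)
      then show ?case using elim by (simp add: ev.hom_mult)
    qed
    then show False by simp
  qed
  ultimately show ?thesis by (simp add: solves_for_def)
qed

text \<open>
  Having degree \<open>1\<close> in \<open>s(n+j)\<close>, a product has a factor free of \<open>s(n+j)\<close>, and the other factor
  again solves for \<open>s(n+j)\<close>.  If the product has least total degree, the first factor is a constant.
\<close>

lemma ex_irreducible_solves_for:
  assumes "solves_for j q"
  shows "\<exists>q. irreducible q \<and> solves_for j q"
proof -
  define q where "q = (ARG_MIN total_degree q. solves_for j q)"
  have q: "solves_for j q" and min: "\<And>b. solves_for j b \<Longrightarrow> total_degree q \<le> total_degree b"
    using assms arg_min_natI[of "solves_for j"] arg_min_nat_le[of "solves_for j"]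
    unfolding q_def by blast+
  have "q \<noteq> 0" using q by (auto simp: solves_for_def)
  have unit: "a dvd 1" if "q = a * b" "degree_in j a = 0" for a b
  proof -
    have "solves_for j b" using solves_for_factor q that by metis
    then have "total_degree a = 0"
      using min[of b] \<open>q \<noteq> 0\<close> that(1) by (simp add: total_degree_mult)
    then obtain c where c: "a = Const c" using total_degree_0_imp_Const by blast
    with \<open>q \<noteq> 0\<close> that(1) have "c \<noteq> 0" by auto
    then have "a * Const (inverse c) = 1" by (simp add: c flip: Const_mult)
    then show ?thesis by (metis dvdI)
  qed
  have "irreducible q"
  proof (rule irreducibleI)
    show "q \<noteq> 0" by fact
    show "\<not> q dvd 1"
    proof
      assume "q dvd 1"
      then obtain r where r: "1 = q * r" ..
      then have "degree_in j q + degree_in j r = degree_in j (1 :: 'a mpoly)"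
        using degree_in_mult[of q r] by (metis mult_eq_0_iff zero_neq_one)
      then show False using q degree_in_Const[of j "1 :: 'a"] by (simp add: solves_for_def)
    qed
    fix a b assume ab: "q = a * b"
    then have "degree_in j a + degree_in j b = 1"
      using q \<open>q \<noteq> 0\<close> degree_in_mult[of a b j] by (auto simp: solves_for_def)
    then have "degree_in j a = 0 \<or> degree_in j b = 0" by auto
    then show "a dvd 1 \<or> b dvd 1"
      using unit[OF ab] unit[of b a] ab by (auto simp: mult.commute)
  qed
  then show ?thesis using q by blast
qed

end

section \<open>Existence of the generic solution\<close>

text \<open>The values below \<open>M\<close> are junk.\<close>

function generic_sequence :: "(nat \<Rightarrow> 'a::field_char_0 poly) \<Rightarrow> nat \<Rightarrow> nat \<Rightarrow> nat \<Rightarrow> 'a mpoly" where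
  "generic_sequence P l M n = (if n < M + l then Var (Suc (n - M))
    else Const (- 1 / poly (P l) (of_nat (n - l))) *
      (\<Sum>i<l. Const (poly (P i) (of_nat (n - l))) * generic_sequence P l M (n - l + i)))"
  by pat_completeness auto
termination by (relation "measure (\<lambda>(P, l, M, n). n)") auto

declare generic_sequence.simps [simp del]

lemma generic_sequence_init: "j < l \<Longrightarrow> generic_sequence P l M (M + j) = Var (Suc j)"
  by (simp add: generic_sequence.simps[of P l M "M + j"])

lemma generic_sequence_rec:
  assumes "k \<ge> M" "poly (P l) (of_nat k) \<noteq> 0"
  shows "(\<Sum>i\<le>l. Const (poly (P i) (of_nat k)) * generic_sequence P l M (k + i)) = 0"
proof -
  have "generic_sequence P l M (k + l) = Const (- 1 / poly (P l) (of_nat k)) *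
      (\<Sum>i<l. Const (poly (P i) (of_nat k)) * generic_sequence P l M (k + i))"
    using assms(1) by (subst generic_sequence.simps) simp
  then have "Const (poly (P l) (of_nat k)) * generic_sequence P l M (k + l) =
      Const (- 1) * (\<Sum>i<l. Const (poly (P i) (of_nat k)) * generic_sequence P l M (k + i))"
    using assms(2) by (simp add: mult.assoc[symmetric] Const_mult[symmetric])
  then show ?thesis
    by (simp add: ring_homomorphism.hom_uminus[OF ring_homomorphism_Const] flip: lessThan_Suc_atMost)
qed

lemma ring_homomorphism_to_fract: "ring_homomorphism to_fract"
  by unfold_locales simp_all

lemma ring_homomorphism_emb: "ring_homomorphism emb"
  unfolding emb_def by (rule ring_homomorphism_comp[OF ring_homomorphism_to_fract ring_homomorphism_Const])

lemma diff_value_to_fract: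
  "diff_value q (\<lambda>n. to_fract (f n)) k = to_fract (subst_mpoly Const (\<lambda>j. f (k + j)) q)"
  unfolding diff_value_def
  by (rule hom_eqI[OF ring_homomorphism.ring_homomorphism_subst[OF ring_homomorphism_emb]
        ring_homomorphism_comp[OF ring_homomorphism_to_fract ring_homomorphism.ring_homomorphism_subst[OF ring_homomorphism_Const]]])
    (simp_all add: ring_homomorphism.subst_Const[OF ring_homomorphism_emb] ring_homomorphism.subst_Var[OF ring_homomorphism_emb]
      ring_homomorphism.subst_Const[OF ring_homomorphism_Const] ring_homomorphism.subst_Var[OF ring_homomorphism_Const] emb_def)

lemma hol_value_linear:
  "hol_value (\<Sum>i\<le>l. Const (P i) * Var i) (\<lambda>n. to_fract (f n)) k =
    to_fract (\<Sum>i\<le>l. Const (poly (P i) (of_nat k)) * f (k + i))"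
proof -
  interpret h: ring_homomorphism "\<lambda>c :: 'a poly. emb (poly c (of_nat k))"
    by (rule ring_homomorphism_comp[OF ring_homomorphism_emb ring_homomorphism_poly])
  show ?thesis
    unfolding hol_value_def
    by (simp add: h.subst_sum h.subst_mult ring_homomorphism.hom_sum[OF ring_homomorphism_to_fract])
      (simp add: emb_def)
qed

section \<open>Holonomic difference polynomials\<close>

context
  fixes p :: "'a::field_char_0 poly mpoly" and P :: "nat \<Rightarrow> 'a poly" and l :: nat
  assumes p: "p = (\<Sum>i\<le>l. Const (P i) * Var i)" and P_l: "P l \<noteq> 0"
begin

lemma lookup_holonomic:
  "Poly_Mapping.lookup p m = (\<Sum>i\<le>l. if m = Poly_Mapping.single i 1 then P i else 0)"
  unfolding p by (simp add: lookup_sum Const_def Var_def mult_single lookup_single when_def eq_commute)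

lemma lookup_holonomic_single:
  assumes "i \<le> l"
  shows "Poly_Mapping.lookup p (Poly_Mapping.single i (Suc 0)) = P i"
proof -
  have "Poly_Mapping.single i (Suc 0) = Poly_Mapping.single j (Suc 0) \<longleftrightarrow> i = j" for i j :: nat
    by (metis keys_single nat.distinct(1) singleton_inject)
  then show ?thesis using assms by (simp add: lookup_holonomic)
qed

lemma keys_holonomic:
  "Poly_Mapping.keys p = (\<lambda>i. Poly_Mapping.single i 1) ` {i. i \<le> l \<and> P i \<noteq> 0}"
proof (intro equalityI subsetI)
  fix m assume "m \<in> Poly_Mapping.keys p"
  then have m: "Poly_Mapping.lookup p m \<noteq> 0" by (simp add: in_keys_iff)
  then obtain i where "i \<le> l" "m = Poly_Mapping.single i 1"
    unfolding lookup_holonomic by (auto elim!: sum.not_neutral_contains_not_neutral split: if_splits)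
  with m show "m \<in> (\<lambda>i. Poly_Mapping.single i 1) ` {i. i \<le> l \<and> P i \<noteq> 0}"
    by (auto simp: lookup_holonomic_single)
qed (auto simp: in_keys_iff lookup_holonomic_single)

lemma diff_ord_holonomic: "diff_ord p = l"
  unfolding diff_ord_def keys_holonomic
  by (rule Max_eqI) (use P_l in \<open>auto intro: finite_subset[of _ "{..l}"]\<close>)

lemma degree_le_holonomic_degree:
  assumes "i \<le> l"
  shows "degree (P i) \<le> holonomic_degree p"
proof (cases "P i = 0")
  case False
  then have "Poly_Mapping.single i 1 \<in> Poly_Mapping.keys p"
    using assms by (auto simp: keys_holonomic)
  then show ?thesis
    unfolding holonomic_degree_def using lookup_holonomic_single[OF assms]
    by (intro Max_ge) (auto intro!: image_eqI[of _ _ "Poly_Mapping.single i 1"])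
qed simp

lemma poly_neq_0_beyond_max_root:
  assumes "i \<le> l" "P i \<noteq> 0" "int k > max_root p"
  shows "poly (P i) (of_nat k) \<noteq> 0"
proof
  assume "poly (P i) (of_nat k) = 0"
  then have k: "k \<in> nat_roots p"
    using assms(1,2) unfolding nat_roots_def keys_holonomic by (auto simp: lookup_holonomic_single)
  have "nat_roots p = (\<Union>m\<in>Poly_Mapping.keys p. of_nat -` {x. poly (Poly_Mapping.lookup p m) x = 0})"
    by (auto simp: nat_roots_def)
  also have "finite \<dots>"
    by (intro finite_UN_I finite_vimageI poly_roots_finite) (auto simp: in_keys_iff inj_on_def)
  finally show False
    using k assms(3) Max_ge[of "nat_roots p" k] by (auto simp: max_root_def split: if_splits)
qed

end

section \<open>Rationalizing difference polynomials of order at most \<open>l + d\<close>\<close>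

theorem theorem4p5:
  fixes l d :: nat
  shows "almost_every_holonomic l d
    {q :: 'a::{alg_closed_field, field_char_0} mpoly. rationalizing q \<and> diff_ord q \<le> l + d}"
  unfolding almost_every_holonomic_def
proof (intro allI impI, elim conjE)
  fix p :: "'a poly mpoly"
  assume "holonomic p l" and d: "holonomic_degree p = d"
  then obtain P where P_l: "P l \<noteq> 0" and p: "p = (\<Sum>i\<le>l. Const (P i) * Var i)"
    by (auto simp: holonomic_def)
  define M where "M = nat (max_root p + 1)"
  have M: "max_root p = int M - 1" by (simp add: M_def max_root_def)
  \<comment> \<open>the recurrence effectively starts at its first nonzero coefficient\<close>
  define t where "t = (LEAST i. P i \<noteq> 0)"
  have t: "P t \<noteq> 0" "t \<le> l" "\<And>i. i < t \<Longrightarrow> P i = 0"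
    unfolding t_def
    using LeastI[of "\<lambda>i. P i \<noteq> 0", OF P_l] Least_le[of "\<lambda>i. P i \<noteq> 0", OF P_l]
      not_less_Least[of _ "\<lambda>i. P i \<noteq> 0"] by blast+
  have nz: "poly (P i) (of_nat k) \<noteq> 0" if "i \<le> l" "P i \<noteq> 0" "k \<ge> M" for i k
    using poly_neq_0_beyond_max_root[OF p P_l that(1,2)] that(3) by (simp add: M)
  define f where "f = generic_sequence P l M"
  have f_rec: "(\<Sum>i\<le>l. Const (poly (P i) (of_nat k)) * f (k + i)) = 0" if "k \<ge> M" for k
    unfolding f_def using that nz P_l by (intro generic_sequence_rec) auto
  interpret generic_recurrence P t l M f
  proof
    show "(\<Sum>i\<in>{t..l}. Const (poly (P i) (of_nat k)) * f (k + i)) = 0" if "k \<ge> M" for k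
    proof -
      have "(\<Sum>i\<in>{t..l}. Const (poly (P i) (of_nat k)) * f (k + i)) =
          (\<Sum>i\<le>l. Const (poly (P i) (of_nat k)) * f (k + i))"
        by (rule sum.mono_neutral_left) (use t(3) in auto)
      then show ?thesis using f_rec[OF that] by simp
    qed
  qed (use t nz P_l in \<open>auto simp: f_def generic_sequence_init\<close>)
  define e where "e = (\<lambda>n. to_fract (f n))"
  have "generic_solution p e"
    unfolding generic_solution_def diff_ord_holonomic[OF p P_l]
  proof (intro conjI ballI allI impI)
    fix j assume "j \<in> {1..l}"
    then obtain i where "j = Suc i" "i < l" by (cases j) auto
    then show "e (nat (max_root p + int j)) = to_fract (Var j)"
      using init[of i] by (simp add: e_def M nat_int_add)
  next
    fix n assume "int n > max_root p"
    then have "n \<ge> M" by (simp add: M)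
    then show "hol_value p e n = 0"
      unfolding p e_def hol_value_linear by (simp only: f_rec to_fract_0)
  qed
  moreover obtain j where j: "l \<le> j" "j \<le> l + d" "rational_at j"
    using ex_rational_at degree_le_holonomic_degree[OF p P_l] unfolding d by blast
  then obtain q where q: "irreducible q" "solves_for j q"
    using rational_at_imp_solves_for ex_irreducible_solves_for t(2) by (meson order.trans)
  have ord: "diff_ord q = j"
    using q(2) by (intro diff_ord_eqI) (auto simp: solves_for_def shifts_in_def)
  have deg: "degree_in j q = 1" using q(2) by (simp add: solves_for_def)
  have val: "diff_value g e n = to_fract (ev n g)" for g n
    by (simp add: e_def diff_value_to_fract ev_def)
  have "D_algebraic_zero (max_root p) e q"
    using q by (simp add: D_algebraic_zero_def val M initial_def ord deg solves_for_def vanishing_def)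
  ultimately have "almost_all_zeros p q"
    using j by (auto simp: almost_all_zeros_def diff_ord_holonomic[OF p P_l] ord)
  moreover have "rationalizing q" by (simp add: rationalizing_def ord deg)
  ultimately show "\<exists>q\<in>{q. rationalizing q \<and> diff_ord q \<le> l + d}. almost_all_zeros p q"
    using j ord by blast
qed

end
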